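(* Let $m,n$ be positive integers with $m$ even, and let $\mathcal{A}^I=[\underline{\mathcal{A}},\overline{\mathcal{A}}]$ be a symmetric interval tensor in $T_{m,n}$ that is an interval double B-tensor. Then $\mathcal{A}^I$ is an interval P-tensor.
   Context: $[n]=\{1,\dots,n\}$. $T_{m,n}$ is the set of real tensors $\mathcal{A}=(a_{i_1i_2\cdots i_m})$ with all indices in $[n]$. All index tuples $(i_2,\dots,i_m)$ range over $[n]^{m-1}$. A tensor is symmetric if its entries are invariant under all permutations of their indices. For $\underline{\mathcal{A}}\le\overline{\mathcal{A}}$ in $T_{m,n}$ (entrywise), the interval tensor is $\mathcal{A}^I=[\underline{\mathcal{A}},\overline{\mathcal{A}}]=\{\mathcal{A}\in T_{m,n}:\underline{\mathcal{A}}\le\mathcal{A}\le\overline{\mathcal{A}}\}$. It is called symmetric if both $\mathcal{A}^c=\frac{1}{2}(\underline{\mathcal{A}}+\overline{\mathcal{A}})$ and $\Delta=\frac{1}{2}(\overline{\mathcal{A}}-\underline{\mathcal{A}})$ are symmetric tensors (members of $\mathcal{A}^I$ need not themselves be symmetric). For $\mathcal{A}\in T_{m,n}$ and $i_1\in[n]$, $\gamma_{i_1}^+(\mathcal{A}):=\max\{0,a_{i_1i_2\cdots i_m}:(i_2,\dots,i_m)\neq(i_1,\dots,i_1)\}$. Double B-tensor: $\mathcal{A}\in T_{m,n}$ is a double B-tensor if for all $i_1\in[n]$: (i) $a_{i_1i_1\cdots i_1}>\gamma_{i_1}^+(\mathcal{A})$; (ii) $a_{i_1i_1\cdots i_1}-\gamma_{i_1}^+(\mathcal{A})\ge\sum_{(i_2,\dots,i_m)\neq(i_1,\dots,i_1)}(\gamma_{i_1}^+(\mathcal{A})-a_{i_1i_2\cdots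 i_m})$; (iii) for all $j_1\neq i_1$, $$(a_{i_1\cdots i_1}-\gamma_{i_1}^+(\mathcal{A}))(a_{j_1\cdots j_1}-\gamma_{j_1}^+(\mathcal{A}))>\Big(\sum_{(i_2,\dots,i_m)\neq(i_1,\dots,i_1)}(\gamma_{i_1}^+(\mathcal{A})-a_{i_1i_2\cdots i_m})\Big)\Big(\sum_{(j_2,\dots,j_m)\neq(j_1,\dots,j_1)}(\gamma_{j_1}^+(\mathcal{A})-a_{j_1j_2\cdots j_m})\Big).$$ For $\mathbf{x}\in\mathbb{R}^n$, $\mathcal{A}\mathbf{x}^{m-1}\in\mathbb{R}^n$ has components $(\mathcal{A}\mathbf{x}^{m-1})_i=\sum_{i_2,\dots,i_m=1}^n a_{ii_2\cdots i_m}x_{i_2}\cdots x_{i_m}$. $\mathcal{A}$ is a P-tensor if for every $\mathbf{x}\in\mathbb{R}^n\setminus\{\mathbf{0}\}$ there is $i\in[n]$ with $x_i^{m-1}(\mathcal{A}\mathbf{x}^{m-1})_i>0$. $\mathcal{A}^I$ is an interval double B-tensor (resp. interval P-tensor) if every $\mathcal{A}\in\mathcal{A}^I$ is a double B-tensor (resp. P-tensor). *)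

theory Defs
  imports "HOL-Analysis.Analysis" "HOL-Combinatorics.Permutations"
begin

text \<open>
  The index set \<open>[n]\<close> is a finite type \<open>'n\<close> with \<open>CARD('n) = n\<close>. A tensor of order \<open>m\<close> maps index
  lists \<open>[i\<^sub>1, \<dots>, i\<^sub>m]\<close> to entries; its values on lists of length other than \<open>m\<close> are junk that no
  definition below consults, so the order is passed to the definitions explicitly.
\<close>

type_synonym 'n tensor = "'n list \<Rightarrow> real"

definition tensor_le :: "nat \<Rightarrow> 'n tensor \<Rightarrow> 'n tensor \<Rightarrow> bool" where
  "tensor_le m A B \<longleftrightarrow> (\<forall>is. length is = m \<longrightarrow> A is \<le> B is)"

definition symmetric_tensor :: "nat \<Rightarrow> 'n tensor \<Rightarrow> bool" where
  "symmetric_tensor m A \<longleftrightarrow>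
     (\<forall>is p. length is = m \<and> p permutes {..<m} \<longrightarrow> A (permute_list p is) = A is)"

definition interval_tensor :: "nat \<Rightarrow> 'n tensor \<Rightarrow> 'n tensor \<Rightarrow> 'n tensor set" where
  "interval_tensor m L U = {A. tensor_le m L A \<and> tensor_le m A U}"

definition symmetric_interval_tensor :: "nat \<Rightarrow> 'n tensor \<Rightarrow> 'n tensor \<Rightarrow> bool" where
  "symmetric_interval_tensor m L U \<longleftrightarrow>
     symmetric_tensor m (\<lambda>is. (L is + U is) / 2) \<and>
     symmetric_tensor m (\<lambda>is. (U is - L is) / 2)"

text \<open>The tuples \<open>(i\<^sub>2, \<dots>, i\<^sub>m) \<noteq> (i, \<dots>, i)\<close>.\<close>

definition offdiag :: "nat \<Rightarrow> 'n \<Rightarrow> 'n list set" where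
  "offdiag m i = {js. length js = m - 1 \<and> js \<noteq> replicate (m - 1) i}"

definition gamma_plus :: "nat \<Rightarrow> 'n::finite tensor \<Rightarrow> 'n \<Rightarrow> real" where
  "gamma_plus m A i = Max (insert 0 ((\<lambda>js. A (i # js)) ` offdiag m i))"

definition double_B_tensor :: "nat \<Rightarrow> 'n::finite tensor \<Rightarrow> bool" where
  "double_B_tensor m A \<longleftrightarrow>
     (\<forall>i. A (replicate m i) > gamma_plus m A i \<and>
          A (replicate m i) - gamma_plus m A i
            \<ge> (\<Sum>js\<in>offdiag m i. gamma_plus m A i - A (i # js)) \<and>
          (\<forall>j. j \<noteq> i \<longrightarrow>
             (A (replicate m i) - gamma_plus m A i) * (A (replicate m j) - gamma_plus m A j)
               > (\<Sum>js\<in>offdiag m i. gamma_plus m A i - A (i # js))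
                 * (\<Sum>js\<in>offdiag m j. gamma_plus m A j - A (j # js))))"

text \<open>The vector \<open>\<A>x\<^sup>m\<^sup>-\<^sup>1\<close>.\<close>

definition tensor_apply :: "nat \<Rightarrow> 'n::finite tensor \<Rightarrow> real ^ 'n \<Rightarrow> real ^ 'n" where
  "tensor_apply m A x =
     (\<chi> i. \<Sum>js | length js = m - 1. A (i # js) * prod_list (map (\<lambda>j. x $ j) js))"

definition P_tensor :: "nat \<Rightarrow> 'n::finite tensor \<Rightarrow> bool" where
  "P_tensor m A \<longleftrightarrow> (\<forall>x. x \<noteq> 0 \<longrightarrow> (\<exists>i. (x $ i) ^ (m - 1) * tensor_apply m A x $ i > 0))"

definition interval_double_B_tensor :: "nat \<Rightarrow> 'n::finite tensor \<Rightarrow> 'n tensor \<Rightarrow> bool" where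
  "interval_double_B_tensor m L U \<longleftrightarrow> (\<forall>A\<in>interval_tensor m L U. double_B_tensor m A)"

definition interval_P_tensor :: "nat \<Rightarrow> 'n::finite tensor \<Rightarrow> 'n tensor \<Rightarrow> bool" where
  "interval_P_tensor m L U \<longleftrightarrow> (\<forall>A\<in>interval_tensor m L U. P_tensor m A)"

end

theory Submission
  imports Defs
begin

text \<open>
  For even \<open>m\<close> a tensor \<open>\<A>\<close> is a P-tensor as soon as its form \<open>\<A>x\<^sup>m = \<Sum>\<^sub>i x\<^sub>i(\<A>x\<^sup>m\<^sup>-\<^sup>1)\<^sub>i\<close> is
  positive for all \<open>x \<noteq> 0\<close>. The form of a member \<open>\<A>\<close> of the interval can be bounded below by the
  form of a \<^emph>\<open>symmetric\<close> member \<open>\<S>\<close>, which depends on \<open>x\<close>: choose each entry of \<open>\<S>\<close> at the endpoint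
  of its interval that minimises its product with \<open>x\<^sub>i\<^sub>1 \<cdots> x\<^sub>i\<^sub>m\<close>, or at the midpoint if that
  monomial vanishes (\<open>interval_tensor_symmetric_minorant\<close>). The sign of the monomial is invariant
  under permutation of the indices, and since the midpoint and the radius are symmetric, so is
  \<open>\<S>\<close>. It remains to prove that a symmetric double B-tensor \<open>\<A>\<close> of even order has a positive form (\<open>symmetric_double_B_tensor_form_pos\<close>).

  Let \<open>J\<close> be the set of rows that have a positive off-diagonal entry. By symmetry all indices of a
  positive off-diagonal entry lie in \<open>J\<close>. Hence, if \<open>h\<close> is the least positive row maximum and \<open>h\<close>
  is subtracted from all entries with indices in \<open>J\<close>, every row maximum in \<open>J\<close> drops by exactly
  \<open>h\<close>, the tensor is still a symmetric double B-tensor (\<open>double_B_tensor_peel\<close>), and \<open>J\<close> has become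
  smaller. The form has decreased by \<open>h (\<Sum>\<^sub>i\<^sub>\<in>\<^sub>J x\<^sub>i)\<^sup>m \<ge> 0\<close>. By induction on the size of \<open>J\<close> all
  off-diagonal entries may be assumed nonpositive (\<open>Z_tensor_form_pos\<close>). In that case let \<open>a\<^sub>i\<close> be
  the diagonal entries and \<open>r\<^sub>i\<close> the sums of the absolute values of the other entries of row \<open>i\<close>.
  The inequality of arithmetic and geometric means and symmetry give
  \<open>\<A>x\<^sup>m \<ge> \<Sum>\<^sub>i (a\<^sub>i - r\<^sub>i) \<bar>x\<^sub>i\<bar>\<^sup>m\<close>. All summands are nonnegative, and since \<open>a\<^sub>i a\<^sub>j > r\<^sub>i r\<^sub>j\<close> for
  \<open>i \<noteq> j\<close> at most one factor \<open>a\<^sub>i - r\<^sub>i\<close> vanishes. So the sum is positive unless \<open>x\<close> is supported on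
  a single index \<open>i\<close>, where \<open>\<A>x\<^sup>m = a\<^sub>i x\<^sub>i\<^sup>m > 0\<close>.
\<close>

section \<open>Sums over index tuples\<close>

lemma finite_tuples [simp]: "finite {js :: 'n::finite list. length js = k}"
  using finite_lists_length_eq[of "UNIV :: 'n set" k] by simp

lemma finite_offdiag [simp]: "finite (offdiag m (i :: 'n::finite))"
  unfolding offdiag_def by (rule finite_subset[OF _ finite_tuples[of "m - 1"]]) auto

lemma sum_tuples_head_tail:
  fixes f :: "'n::finite list \<Rightarrow> 'b::comm_monoid_add"
  assumes "m > 0"
  shows "(\<Sum>is | length is = m. f is) = (\<Sum>i\<in>UNIV. \<Sum>js | length js = m - 1. f (i # js))"
proof -
  have "(\<Sum>i\<in>UNIV. \<Sum>js | length js = m - 1. f (i # js))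
      = (\<Sum>(i, js)\<in>UNIV \<times> {js. length js = m - 1}. f (i # js))"
    by (rule sum.cartesian_product)
  also have "\<dots> = (\<Sum>is | length is = m. f is)"
    by (rule sum.reindex_bij_witness[where i = "\<lambda>is. (hd is, tl is)" and j = "\<lambda>(i, js). i # js"])
       (use assms in \<open>auto simp: hd_Cons_tl simp flip: length_greater_0_conv\<close>)
  finally show ?thesis ..
qed

lemma sum_row_split:
  fixes g :: "'n::finite list \<Rightarrow> 'b::comm_monoid_add"
  shows "(\<Sum>js | length js = m - 1. g js) = g (replicate (m - 1) i) + sum g (offdiag m i)"
proof -
  have "{js. length js = m - 1} = insert (replicate (m - 1) i) (offdiag m i)"
    by (auto simp: offdiag_def)
  moreover have "replicate (m - 1) i \<notin> offdiag m i" by (simp add: offdiag_def)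
  ultimately show ?thesis by simp
qed

lemma Cons_replicate_pred: "m > 0 \<Longrightarrow> i # replicate (m - 1) i = replicate m i"
  by (cases m) auto

text \<open>The form of the tensor that is \<open>1\<close> on the tuples over \<open>J\<close> and \<open>0\<close> elsewhere is a pure power,
  hence nonnegative in even order.\<close>

lemma power_sum_tuples:
  fixes x :: "'n::finite \<Rightarrow> real"
  shows "(\<Sum>is | length is = m. if set is \<subseteq> J then prod_list (map x is) else 0) = (\<Sum>i\<in>J. x i) ^ m"
proof (induction m)
  case 0
  have "{is :: 'n list. length is = 0} = {[]}" by auto
  then show ?case by simp
next
  case (Suc m)
  have "(\<Sum>is | length is = Suc m. if set is \<subseteq> J then prod_list (map x is) else 0)
      = (\<Sum>i\<in>UNIV. \<Sum>js | length js = m.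
           (if i \<in> J then x i else 0) * (if set js \<subseteq> J then prod_list (map x js) else 0))"
    by (subst sum_tuples_head_tail) (auto intro!: sum.cong)
  also have "\<dots> = (\<Sum>i\<in>UNIV. if i \<in> J then x i else 0) * (\<Sum>i\<in>J. x i) ^ m"
    by (simp add: Suc.IH sum_distrib_right flip: sum_distrib_left)
  also have "(\<Sum>i\<in>UNIV. if i \<in> J then x i else 0) = (\<Sum>i\<in>J. x i)"
    by (simp add: sum.If_cases)
  finally show ?case by simp
qed

section \<open>Symmetric tensors and their forms\<close>

definition tensor_form :: "nat \<Rightarrow> 'n::finite tensor \<Rightarrow> ('n \<Rightarrow> real) \<Rightarrow> real" where
  "tensor_form m A x = (\<Sum>is | length is = m. A is * prod_list (map x is))"

lemma tensor_form_eq_inner_apply: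
  assumes "m > 0"
  shows "tensor_form m A (($) x) = (\<Sum>i\<in>UNIV. x $ i * tensor_apply m A x $ i)"
  unfolding tensor_form_def sum_tuples_head_tail[OF assms] tensor_apply_def
  by (simp add: sum_distrib_left mult_ac)

text \<open>For even \<open>m\<close> the factor \<open>x\<^sub>i\<^sup>m\<^sup>-\<^sup>1\<close> has the sign of \<open>x\<^sub>i\<close>, and \<open>x\<^sub>i(\<A>x\<^sup>m\<^sup>-\<^sup>1)\<^sub>i\<close> are the
  summands of the form; a positive sum has a positive summand.\<close>

lemma P_tensor_if_tensor_form_pos:
  assumes "m > 0" "even m"
    and pos: "\<And>x. (\<exists>i. x i \<noteq> 0) \<Longrightarrow> tensor_form m A x > 0"
  shows "P_tensor m A"
  unfolding P_tensor_def
proof (intro allI impI)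
  fix x :: "real ^ 'a" assume "x \<noteq> 0"
  then have "tensor_form m A (($) x) > 0"
    by (intro pos) (auto simp: vec_eq_iff)
  then obtain i where i: "x $ i * tensor_apply m A x $ i > 0"
    unfolding tensor_form_eq_inner_apply[OF assms(1)] by (meson not_less sum_nonpos)
  have m: "m - 1 = Suc (m - 2)" "even (m - 2)" using assms(1,2) by (auto elim!: evenE)
  have "(x $ i) ^ (m - 2) > 0" using i m(2) by (auto simp: zero_less_power_eq)
  with i have "(x $ i) ^ (m - 2) * (x $ i * tensor_apply m A x $ i) > 0" by simp
  then show "\<exists>i. (x $ i) ^ (m - 1) * tensor_apply m A x $ i > 0"
    unfolding m(1) by (auto simp: mult_ac intro!: exI[of _ i])
qed

lemma symmetric_tensor_mset_cong:
  assumes "symmetric_tensor m A" "length is = m" "mset js = mset is"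
  shows "A js = A is"
  by (metis assms mset_eq_permutation symmetric_tensor_def)

lemma symmetric_tensorI:
  assumes "\<And>is js. length is = m \<Longrightarrow> mset js = mset is \<Longrightarrow> A js = A is"
  shows "symmetric_tensor m A"
  unfolding symmetric_tensor_def using assms mset_permute_list by blast

lemma prod_list_map_mset_cong:
  fixes x :: "'n \<Rightarrow> real"
  shows "mset js = mset is \<Longrightarrow> prod_list (map x js) = prod_list (map x is)"
  by (metis mset_map prod_mset_prod_list)

text \<open>Reindex the sum by exchanging the positions \<open>0\<close> and \<open>k\<close> of every tuple.\<close>

lemma symmetric_sum_nth_eq_sum_hd:
  fixes B :: "'n::finite tensor" and f :: "'n \<Rightarrow> real"
  assumes "symmetric_tensor m B" "k < m"
  shows "(\<Sum>is | length is = m. B is * f (is ! k)) = (\<Sum>is | length is = m. B is * f (hd is))"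
proof -
  define p where "p = Transposition.transpose 0 k"
  have p: "p permutes {..<m}" unfolding p_def using assms(2) by (intro permutes_swap_id) auto
  have pp: "p \<circ> p = id" by (simp add: p_def)
  have inv: "permute_list p (permute_list p is) = is" if "length is = m" for "is" :: "'n list"
    using permute_list_compose[of p "is" p] p that pp by simp
  have hd: "hd (permute_list p is) = is ! k" if "length is = m" for "is" :: "'n list"
  proof -
    have "hd (permute_list p is) = permute_list p is ! 0"
      using that assms(2) by (intro hd_conv_nth) (auto simp flip: length_0_conv)
    also have "\<dots> = is ! k" using that assms(2) p by (subst permute_list_nth) (auto simp: p_def)
    finally show ?thesis .
  qed
  have "B (permute_list p is) = B is" if "length is = m" for "is"
    using assms(1) p that by (auto simp: symmetric_tensor_def)
  then show ?thesis
    by (intro sum.reindex_bij_witness[where i = "permute_list p" and j = "permute_list p"])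
       (auto simp: inv hd)
qed

lemma abs_prod_list_le_mean_power:
  fixes x :: "'n \<Rightarrow> real"
  assumes "length is = m" "m > 0"
  shows "\<bar>prod_list (map x is)\<bar> \<le> (\<Sum>k<m. \<bar>x (is ! k)\<bar> ^ m) / m"
proof -
  let ?P = "\<Prod>k<m. \<bar>x (is ! k)\<bar>"
  have "\<bar>prod_list (map x is)\<bar> = ?P"
    using assms by (simp add: prod.list_conv_set_nth abs_prod atLeast0LessThan)
  also have "?P = (\<Prod>k<m. \<bar>x (is ! k)\<bar> ^ m) powr (1 / card {..<m})"
  proof -
    have "(P ^ m) powr (1 / m) = P" if "P \<ge> 0" for P :: real
      using that assms(2) by (cases "P = 0") (auto simp: powr_powr simp flip: powr_realpow)
    moreover have "?P \<ge> 0" by (simp add: prod_nonneg)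
    ultimately show ?thesis by (simp flip: prod_power_distrib)
  qed
  also have "\<dots> \<le> (\<Sum>k<m. \<bar>x (is ! k)\<bar> ^ m / card {..<m})"
    using assms(2) by (intro arith_geom_mean) auto
  finally show ?thesis by (simp add: sum_divide_distrib)
qed

text \<open>The inequality of arithmetic and geometric means bounds each monomial by the mean of the
  powers \<open>\<bar>x\<^sub>i\<^sub>k\<bar>\<^sup>m\<close>; by symmetry all \<open>m\<close> positions \<open>k\<close> contribute the same to the sum, and the
  position of the row index contributes the row sums.\<close>

lemma symmetric_tensor_form_le_row_sums:
  fixes B :: "'n::finite tensor"
  assumes sym: "symmetric_tensor m B" and "m > 0"
    and nonneg: "\<And>is. length is = m \<Longrightarrow> B is \<ge> 0"
  shows "tensor_form m B x \<le> (\<Sum>i\<in>UNIV. (\<Sum>js | length js = m - 1. B (i # js)) * \<bar>x i\<bar> ^ m)"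
proof -
  have "tensor_form m B x \<le> (\<Sum>is | length is = m. B is * ((\<Sum>k<m. \<bar>x (is ! k)\<bar> ^ m) / m))"
    unfolding tensor_form_def
  proof (rule sum_mono)
    fix "is" :: "'n list" assume "is \<in> {is. length is = m}"
    then show "B is * prod_list (map x is) \<le> B is * ((\<Sum>k<m. \<bar>x (is ! k)\<bar> ^ m) / m)"
      using abs_prod_list_le_mean_power[of "is" m x] nonneg[of "is"] \<open>m > 0\<close>
      by (intro mult_left_mono) auto
  qed
  also have "\<dots> = (\<Sum>k<m. \<Sum>is | length is = m. B is * \<bar>x (is ! k)\<bar> ^ m) / m"
    by (subst sum.swap) (simp add: sum_distrib_left sum_divide_distrib)
  also have "\<dots> = (\<Sum>k<m. \<Sum>is | length is = m. B is * \<bar>x (hd is)\<bar> ^ m) / m"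
    using symmetric_sum_nth_eq_sum_hd[OF sym, of _ "\<lambda>i. \<bar>x i\<bar> ^ m"] by simp
  also have "\<dots> = (\<Sum>is | length is = m. B is * \<bar>x (hd is)\<bar> ^ m)"
    using \<open>m > 0\<close> by simp
  also have "\<dots> = (\<Sum>i\<in>UNIV. (\<Sum>js | length js = m - 1. B (i # js)) * \<bar>x i\<bar> ^ m)"
    by (simp add: sum_tuples_head_tail[OF \<open>m > 0\<close>] sum_distrib_right)
  finally show ?thesis .
qed

section \<open>Row maxima\<close>

lemma gamma_plus_nonneg: "gamma_plus m A i \<ge> 0"
  unfolding gamma_plus_def by (rule Max_ge) auto

lemma le_gamma_plus: "js \<in> offdiag m i \<Longrightarrow> A (i # js) \<le> gamma_plus m A i"
  unfolding gamma_plus_def by (rule Max_ge) auto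

lemma gamma_plus_attained:
  assumes "gamma_plus m A i > 0"
  obtains js where "js \<in> offdiag m i" "A (i # js) = gamma_plus m A i"
proof -
  have "gamma_plus m A i \<in> insert 0 ((\<lambda>js. A (i # js)) ` offdiag m i)"
    unfolding gamma_plus_def by (rule Max_in) auto
  then show thesis using assms that by auto
qed

lemma gamma_plus_eqI:
  assumes "\<And>js. js \<in> offdiag m i \<Longrightarrow> A (i # js) \<le> c"
    and "js \<in> offdiag m i" "A (i # js) = c" "c \<ge> 0"
  shows "gamma_plus m A i = c"
  unfolding gamma_plus_def using assms by (intro Max_eqI) auto

lemma offdiag_iff_not_const:
  assumes "length (i # js) = m"
  shows "js \<in> offdiag m i \<longleftrightarrow> (\<nexists>k. set (i # js) \<subseteq> {k})"
proof -
  have "js = replicate (m - 1) i \<longleftrightarrow> (\<forall>k\<in>set js. k = i)"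
    by (metis assms diff_Suc_1 in_set_replicate length_Cons replicate_eqI)
  then show ?thesis using assms by (auto simp: offdiag_def)
qed

text \<open>Moving the index \<open>k\<close> to the front turns the entry into an equal off-diagonal entry of row \<open>k\<close>,
  whose maximum is therefore positive too.\<close>

lemma positive_offdiag_entry_support:
  fixes A :: "'n::finite tensor"
  assumes sym: "symmetric_tensor m A" and "m > 0"
    and js: "js \<in> offdiag m i" "A (i # js) > 0"
  shows "set (i # js) \<subseteq> {k. gamma_plus m A k > 0}"
proof
  fix k assume k: "k \<in> set (i # js)"
  have len: "length (i # js) = m" using js \<open>m > 0\<close> by (auto simp: offdiag_def)
  define ks where "ks = remove1 k (i # js)"
  have mset: "mset (k # ks) = mset (i # js)" using k
    unfolding ks_def by (simp only: mset.simps mset_remove1) simp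
  have set: "set (k # ks) = set (i # js)" using mset by (rule mset_eq_setD)
  have "length (k # ks) = m" using mset len by (metis size_mset)
  then have "ks \<in> offdiag m k" using js(1) offdiag_iff_not_const len set by metis
  moreover have "A (k # ks) > 0" using symmetric_tensor_mset_cong[OF sym len mset] js(2) by simp
  ultimately have "gamma_plus m A k > 0" using le_gamma_plus[of ks m k A] by linarith
  then show "k \<in> {k. gamma_plus m A k > 0}" by simp
qed


section \<open>Peeling off partially all-one tensors\<close>

definition peel :: "'n set \<Rightarrow> real \<Rightarrow> 'n tensor \<Rightarrow> 'n tensor" where
  "peel J h A = (\<lambda>is. A is - (if set is \<subseteq> J then h else 0))"

lemma symmetric_tensor_peel: "symmetric_tensor m A \<Longrightarrow> symmetric_tensor m (peel J h A)"
  unfolding peel_def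
  by (rule symmetric_tensorI) (metis mset_eq_setD symmetric_tensor_mset_cong)

lemma tensor_form_peel:
  "tensor_form m A x = tensor_form m (peel J h A) x + h * (\<Sum>i\<in>J. x i) ^ m"
proof -
  have "tensor_form m (peel J h A) x + h * (\<Sum>i\<in>J. x i) ^ m
      = (\<Sum>is | length is = m. peel J h A is * prod_list (map x is)
           + h * (if set is \<subseteq> J then prod_list (map x is) else 0))"
    by (simp add: tensor_form_def sum.distrib sum_distrib_left flip: power_sum_tuples)
  also have "\<dots> = tensor_form m A x"
    unfolding tensor_form_def by (rule sum.cong) (auto simp: peel_def algebra_simps)
  finally show ?thesis ..
qed

text \<open>Every positive off-diagonal entry, in particular a positive row maximum, has all its indices
  in \<open>J\<close>, so the peeling lowers it by exactly \<open>h\<close>; the unchanged entries in the rows of \<open>J\<close> are at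
  most \<open>0\<close>, and \<open>0\<close> is at most the lowered maximum because \<open>h\<close> does not exceed the original one.\<close>

lemma gamma_plus_peel:
  fixes A :: "'n::finite tensor"
  assumes sym: "symmetric_tensor m A" and "m > 0"
    and J: "J = {k. gamma_plus m A k > 0}"
    and h: "\<And>i. i \<in> J \<Longrightarrow> h \<le> gamma_plus m A i"
  shows "gamma_plus m (peel J h A) i = gamma_plus m A i - (if i \<in> J then h else 0)"
proof (cases "i \<in> J")
  case True
  then have pos: "gamma_plus m A i > 0" using J by simp
  then obtain js where js: "js \<in> offdiag m i" "A (i # js) = gamma_plus m A i"
    by (rule gamma_plus_attained)
  have "gamma_plus m (peel J h A) i = gamma_plus m A i - h"
  proof (rule gamma_plus_eqI[OF _ js(1)])
    have "set (i # js) \<subseteq> J"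
      using positive_offdiag_entry_support[OF sym \<open>m > 0\<close> js(1)] js(2) pos J by simp
    then show "peel J h A (i # js) = gamma_plus m A i - h"
      using js(2) by (simp add: peel_def)
    show "gamma_plus m A i - h \<ge> 0" using h[OF True] by simp
    fix ks assume ks: "ks \<in> offdiag m i"
    show "peel J h A (i # ks) \<le> gamma_plus m A i - h"
    proof (cases "set (i # ks) \<subseteq> J")
      case True
      then show ?thesis using le_gamma_plus[OF ks, of A] by (simp add: peel_def)
    next
      case False
      then have "A (i # ks) \<le> 0"
        using positive_offdiag_entry_support[OF sym \<open>m > 0\<close> ks] J by force
      with False show ?thesis using h[OF True] unfolding peel_def by (simp only: if_False)
    qed
  qed
  with True show ?thesis by simp
next
  case False
  then have "(\<lambda>js. peel J h A (i # js)) = (\<lambda>js. A (i # js))" by (simp add: peel_def)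
  then have "gamma_plus m (peel J h A) i = gamma_plus m A i" unfolding gamma_plus_def by metis
  with False show ?thesis by simp
qed

text \<open>The conditions of a double B-tensor speak only of the gaps between the diagonal entries and
  the row maxima and of the total gaps of the off-diagonal entries. The total gaps are nonnegative,
  so their products, like the gaps themselves, can only decrease.\<close>

lemma double_B_tensor_mono:
  fixes A A' :: "'n::finite tensor"
  assumes dB: "double_B_tensor m A"
    and diag: "\<And>i. A' (replicate m i) - gamma_plus m A' i = A (replicate m i) - gamma_plus m A i"
    and off: "\<And>i js. js \<in> offdiag m i \<Longrightarrow>
      gamma_plus m A' i - A' (i # js) \<le> gamma_plus m A i - A (i # js)"
  shows "double_B_tensor m A'"
proof -
  define r where "r i = (\<Sum>js\<in>offdiag m i. gamma_plus m A i - A (i # js))" for i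
  define r' where "r' i = (\<Sum>js\<in>offdiag m i. gamma_plus m A' i - A' (i # js))" for i
  have le: "r' i \<le> r i" for i unfolding r_def r'_def using off by (intro sum_mono)
  have nonneg: "0 \<le> r' i" for i
    unfolding r'_def by (intro sum_nonneg) (simp add: le_gamma_plus)
  have prod_le: "r' i * r' j \<le> r i * r j" for i j
    using le nonneg order_trans[OF nonneg le] by (intro mult_mono) auto
  note dB = dB[unfolded double_B_tensor_def, rule_format]
  show ?thesis
    unfolding double_B_tensor_def r'_def[symmetric] diag
  proof (intro allI conjI impI)
    fix i
    have "gamma_plus m A i < A (replicate m i)" using dB[of i] by blast
    then show "gamma_plus m A' i < A' (replicate m i)" using diag[of i] by linarith
    have "r i \<le> A (replicate m i) - gamma_plus m A i"
      using dB[of i] unfolding r_def by blast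
    then show "r' i \<le> A (replicate m i) - gamma_plus m A i" using le[of i] by linarith
    fix j assume "j \<noteq> i"
    then have "r i * r j
        < (A (replicate m i) - gamma_plus m A i) * (A (replicate m j) - gamma_plus m A j)"
      using dB[of i] unfolding r_def by blast
    with prod_le[of i j] show "r' i * r' j
        < (A (replicate m i) - gamma_plus m A i) * (A (replicate m j) - gamma_plus m A j)"
      by linarith
  qed
qed

lemma double_B_tensor_peel:
  fixes A :: "'n::finite tensor"
  assumes "double_B_tensor m A" and sym: "symmetric_tensor m A" and "m > 0"
    and J: "J = {k. gamma_plus m A k > 0}"
    and h: "\<And>i. i \<in> J \<Longrightarrow> h \<le> gamma_plus m A i" "h \<ge> 0"
  shows "double_B_tensor m (peel J h A)"
proof (rule double_B_tensor_mono[OF assms(1)])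
  have gamma: "gamma_plus m (peel J h A) i = gamma_plus m A i - (if i \<in> J then h else 0)" for i
    using gamma_plus_peel[OF sym \<open>m > 0\<close> J] h(1) .
  show "peel J h A (replicate m i) - gamma_plus m (peel J h A) i
      = A (replicate m i) - gamma_plus m A i" for i
    using \<open>m > 0\<close> unfolding gamma by (simp add: peel_def)
  show "gamma_plus m (peel J h A) i - peel J h A (i # js) \<le> gamma_plus m A i - A (i # js)" for i js
    using h(2) unfolding gamma by (simp add: peel_def)
qed

section \<open>Positive definiteness\<close>

text \<open>When all row maxima are \<open>0\<close>, the tensor is a nonnegative diagonal minus a nonnegative
  off-diagonal part \<open>B\<close> with row sums \<open>r\<close>, and the estimate of the form of \<open>B\<close> by its row sums
  applies.\<close>

lemma Z_tensor_form_pos: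
  fixes A :: "'n::finite tensor"
  assumes sym: "symmetric_tensor m A" and "m > 0" "even m"
    and dB: "double_B_tensor m A"
    and Z: "\<And>i. gamma_plus m A i = 0"
    and x: "x i0 \<noteq> 0"
  shows "tensor_form m A x > 0"
proof -
  define a where "a = (\<lambda>i. A (replicate m i))"
  define r where "r = (\<lambda>i. \<Sum>js\<in>offdiag m i. - A (i # js))"
  have a_pos: "a i > 0" and a_ge: "a i \<ge> r i" and a_mult: "j \<noteq> i \<Longrightarrow> a i * a j > r i * r j" for i j
    using dB unfolding double_B_tensor_def Z a_def r_def by auto

  define B where "B = (\<lambda>is. if \<exists>k. set is \<subseteq> {k} then 0 else - A is)"
  have B_diag: "B (i # replicate (m - 1) i) = 0" for i
    unfolding B_def by (auto intro!: exI[of _ i])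
  have B_off: "B (i # js) = - A (i # js)" if "js \<in> offdiag m i" for i js
    using that offdiag_iff_not_const[of i js m] \<open>m > 0\<close> unfolding B_def offdiag_def by auto
  have B_nonneg: "B is \<ge> 0" if "length is = m" for "is"
  proof (cases "is")
    case (Cons i js)
    then show ?thesis
      using offdiag_iff_not_const[of i js m] le_gamma_plus[of js m i A] Z[of i] that
      by (auto simp: B_def)
  qed (use that \<open>m > 0\<close> in auto)
  have B_sym: "symmetric_tensor m B"
    unfolding B_def
    by (rule symmetric_tensorI) (metis mset_eq_setD symmetric_tensor_mset_cong[OF sym])
  have B_row: "(\<Sum>js | length js = m - 1. B (i # js)) = r i" for i
    unfolding sum_row_split[of _ _ i] B_diag r_def by (simp add: B_off)

  have split: "tensor_form m A x = (\<Sum>i\<in>UNIV. a i * \<bar>x i\<bar> ^ m) - tensor_form m B x"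
  proof -
    have "tensor_form m A x + tensor_form m B x
        = (\<Sum>is | length is = m. (A is + B is) * prod_list (map x is))"
      by (simp add: tensor_form_def sum.distrib distrib_right)
    also have "\<dots> = (\<Sum>i\<in>UNIV. a i * x i ^ m)"
      unfolding sum_tuples_head_tail[OF \<open>m > 0\<close>]
    proof (rule sum.cong[OF refl])
      fix i
      have "prod_list (map x (i # replicate (m - 1) i)) = x i ^ m"
        unfolding Cons_replicate_pred[OF \<open>m > 0\<close>] by simp
      then show "(\<Sum>js | length js = m - 1.
          (A (i # js) + B (i # js)) * prod_list (map x (i # js))) = a i * x i ^ m"
        unfolding sum_row_split[of _ _ i] B_diag
        unfolding Cons_replicate_pred[OF \<open>m > 0\<close>] by (simp add: B_off a_def)
    qed
    finally show ?thesis using \<open>even m\<close> by (simp add: power_even_abs)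
  qed

  show ?thesis
  proof (cases "\<exists>i. x i \<noteq> 0 \<and> a i > r i")
    case True
    then obtain i where i: "x i \<noteq> 0" "a i > r i" by blast
    have "0 < (\<Sum>i\<in>UNIV. (a i - r i) * \<bar>x i\<bar> ^ m)"
      using i a_ge by (intro sum_pos2[of _ i]) auto
    then show ?thesis
      using symmetric_tensor_form_le_row_sums[OF B_sym \<open>m > 0\<close> B_nonneg, of x]
      unfolding split B_row by (simp add: left_diff_distrib sum_subtractf)
  next
    case False
    \<comment> \<open>Two tight rows would contradict the product condition, so \<open>x\<close> is a multiple of a unit
      vector, on which the off-diagonal part vanishes.\<close>
    have tight: "a i = r i" if "x i \<noteq> 0" for i using False that a_ge[of i] by force
    have supp: "x j = 0" if "j \<noteq> i0" for j
      using a_mult[OF that] tight[OF x] tight[of j] by fastforce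
    have "B is * prod_list (map x is) = 0" for "is"
    proof (cases "set is \<subseteq> {i0}")
      case True
      then have "B is = 0" unfolding B_def by auto
      then show ?thesis by simp
    next
      case False
      then have "0 \<in> x ` set is" using supp by force
      then show ?thesis by (simp add: prod_list_zero_iff)
    qed
    then have "tensor_form m B x = 0"
      unfolding tensor_form_def by (intro sum.neutral) blast
    moreover have "0 < (\<Sum>i\<in>UNIV. a i * \<bar>x i\<bar> ^ m)"
      using x a_pos less_imp_le[OF a_pos] by (intro sum_pos2[of _ i0]) auto
    ultimately show ?thesis by (simp add: split)
  qed
qed

text \<open>Each peeling with \<open>h\<close> the least positive row maximum removes at least one index from the set
  of rows with positive maximum and does not increase the form.\<close>

theorem symmetric_double_B_tensor_form_pos:
  fixes A :: "'n::finite tensor"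
  assumes "symmetric_tensor m A" "double_B_tensor m A" and m: "m > 0" "even m"
    and x: "x i0 \<noteq> 0"
  shows "tensor_form m A x > 0"
  using assms(1,2)
proof (induction "card {k. gamma_plus m A k > 0}" arbitrary: A rule: less_induct)
  case less
  define J where "J = {k. gamma_plus m A k > 0}"
  show ?case
  proof (cases "J = {}")
    case True
    then have "gamma_plus m A i = 0" for i
      using gamma_plus_nonneg[of m A i] by (auto simp: J_def set_eq_iff not_less intro: antisym)
    then show ?thesis using less.prems m x by (intro Z_tensor_form_pos)
  next
    case False
    define h where "h = Min (gamma_plus m A ` J)"
    have "h \<in> gamma_plus m A ` J" unfolding h_def using False by (intro Min_in) auto
    then obtain k where k: "k \<in> J" "h = gamma_plus m A k" by blast
    have h_le: "h \<le> gamma_plus m A i" if "i \<in> J" for i unfolding h_def using that by simp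
    have "h > 0" using k by (simp add: J_def)
    let ?A' = "peel J h A"
    have gamma: "gamma_plus m ?A' i = gamma_plus m A i - (if i \<in> J then h else 0)" for i
      using gamma_plus_peel[OF less.prems(1) m(1) J_def] h_le .
    have "{i. gamma_plus m ?A' i > 0} \<subset> J"
    proof (rule psubsetI)
      show "{i. gamma_plus m ?A' i > 0} \<subseteq> J"
        unfolding gamma using \<open>h > 0\<close> by (auto simp: J_def split: if_splits)
      show "{i. gamma_plus m ?A' i > 0} \<noteq> J" using k unfolding gamma by force
    qed
    then have "card {i. gamma_plus m ?A' i > 0} < card {i. gamma_plus m A i > 0}"
      unfolding J_def by (rule psubset_card_mono[rotated]) simp
    then have "tensor_form m ?A' x > 0"
      by (rule less.hyps)
         (use less.prems m h_le \<open>h > 0\<close> in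
            \<open>auto intro!: symmetric_tensor_peel double_B_tensor_peel[OF _ _ _ J_def]\<close>)
    moreover have "h * (\<Sum>i\<in>J. x i) ^ m \<ge> 0" using \<open>h > 0\<close> m(2) by (simp add: zero_le_even_power)
    ultimately show ?thesis unfolding tensor_form_peel[of m A x J h] by linarith
  qed
qed

section \<open>Interval tensors\<close>

text \<open>The minorant is \<open>\<A>\<^sup>c - \<sigma>\<Delta>\<close> with \<open>\<sigma>\<close> the sign of the monomial of the entry: it takes the lower
  bound where the monomial is positive, the upper bound where it is negative, and the centre where
  the monomial vanishes.\<close>

lemma interval_tensor_symmetric_minorant:
  fixes x :: "'n::finite \<Rightarrow> real"
  assumes LU: "tensor_le m L U" and sym: "symmetric_interval_tensor m L U"
    and A: "A \<in> interval_tensor m L U"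
  obtains S where "S \<in> interval_tensor m L U" "symmetric_tensor m S"
    "tensor_form m S x \<le> tensor_form m A x"
proof
  define S where "S = (\<lambda>is. (L is + U is) / 2 - sgn (prod_list (map x is)) * ((U is - L is) / 2))"
  have bounds: "L is \<le> A is" "A is \<le> U is" if "length is = m" for "is"
    using A that by (auto simp: interval_tensor_def tensor_le_def)
  show "S \<in> interval_tensor m L U"
    using LU unfolding interval_tensor_def tensor_le_def S_def by (auto simp: sgn_if field_simps)
  show "symmetric_tensor m S"
  proof (rule symmetric_tensorI)
    fix "is" js :: "'n list" assume *: "length is = m" "mset js = mset is"
    have "(L js + U js) / 2 = (L is + U is) / 2" "(U js - L js) / 2 = (U is - L is) / 2"
      using sym * unfolding symmetric_interval_tensor_def
      by (auto dest: symmetric_tensor_mset_cong)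
    then show "S js = S is" unfolding S_def prod_list_map_mset_cong[OF *(2)] by (simp only:)
  qed
  show "tensor_form m S x \<le> tensor_form m A x"
    unfolding tensor_form_def
  proof (rule sum_mono)
    fix "is" :: "'n list" assume "is \<in> {is. length is = m}"
    then have bounds: "L is \<le> A is" "A is \<le> U is" using bounds by auto
    show "S is * prod_list (map x is) \<le> A is * prod_list (map x is)"
    proof (cases "prod_list (map x is)" "0 :: real" rule: linorder_cases)
      case less
      with bounds show ?thesis
        unfolding S_def by (intro mult_right_mono_neg) (auto simp: field_simps)
    next
      case greater
      with bounds show ?thesis
        unfolding S_def by (intro mult_right_mono) (auto simp: field_simps)
    qed simp
  qed
qed

theorem corollary4p1:
  fixes m :: nat and L U :: "'n::finite tensor"
  assumes "m > 0" and "even m"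
    and "tensor_le m L U"
    and "symmetric_interval_tensor m L U"
    and "interval_double_B_tensor m L U"
  shows "interval_P_tensor m L U"
  unfolding interval_P_tensor_def
proof
  fix A assume A: "A \<in> interval_tensor m L U"
  show "P_tensor m A"
  proof (rule P_tensor_if_tensor_form_pos[OF assms(1,2)])
    fix x :: "'n \<Rightarrow> real" assume "\<exists>i. x i \<noteq> 0"
    then obtain i0 where x: "x i0 \<noteq> 0" ..
    obtain S where S: "S \<in> interval_tensor m L U" "symmetric_tensor m S"
      "tensor_form m S x \<le> tensor_form m A x"
      using interval_tensor_symmetric_minorant[OF assms(3,4) A] .
    have "double_B_tensor m S" using assms(5) S(1) by (simp add: interval_double_B_tensor_def)
    then have "tensor_form m S x > 0"
      using symmetric_double_B_tensor_form_pos S(2) assms(1,2) x by blast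
    with S(3) show "tensor_form m A x > 0" by simp
  qed
qed

end
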